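(* Consider a finite-horizon Markov decision process $\mathcal M=(\mathcal S,\mathcal A,P,C,T,\rho)$ and a parameterized policy class $\Pi_\Theta$ with $\Theta=\Theta_1\times\dots\times\Theta_T$ convex and compact. Suppose the following hold. (1) (Bounded gradients) For every $\theta\in\Theta$ and $t\in\{1,\dots,T\}$, the function $\theta_t\mapsto \mathbb E_{s_t\sim\rho_t(\cdot|\pi_\theta)}\big[Q_t^{\pi_\theta}(s_t,\pi_t(s_t|\theta_t))\big]$ is continuously differentiable on $\Theta_t$ with the $2$-norm of its gradient bounded above by $G$. (2) (PŁK condition of expected optimal Q-value functions) For every $\theta\in\Theta$ and $t\in\{1,\dots,T\}$, the function $\theta_t\mapsto \mathbb E_{s_t\sim\rho_t(\cdot|\pi_\theta)}\big[Q_t^{\pi_{\theta^*}}(s_t,\pi_t(s_t|\theta_t))\big]$ satisfies the PŁK condition on $\Theta_t$ with constant $\mu_Q$. (3) (Sequential decomposition inequality) There exists $M_g>0$ such that for all $\theta\in\Theta$ and $1\le t<k\le T$, $$\big\|\nabla_{\theta_t} l(\theta_1,\dots,\theta_{k-1},\theta_k,\theta_{k+1}^*,\dots,\theta_T^* )-\nabla_{\theta_t} l(\theta_1,\dots,\theta_{k-1},\theta_k^*,\theta_{k+1}^*,\dots,\theta_T^* )\big\|_2$$ $$\le M_g\Big(\mathbb E_{s_k\sim\rho_k(\cdot|\pi_\theta)}\big[Q_k^{\pi_{\theta^*}}(s_k,\pi_k(s_k|\theta_k))\big]-\mathbb E_{s_k\sim\rho_k(\cdot|\pi_\theta)}\big[Q_k^{\pi_{\theta^*}}(s_k,\pi_k(s_k|\theta_k^*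 ))\big]\Big).$$ Then the policy gradient objective $l$ satisfies the PŁK condition on $\Theta$ with constant $\mu_l=\frac{\mu_Q^3}{eM_g^2G^2T^2}$, i.e. $$l(\theta)-l(\theta^* )\le\frac{eM_g^2G^2T^2}{2\mu_Q^3}\min_{g\in N_\Theta(\theta)}\|\nabla l(\theta)+g\|_2^2\qquad\forall\theta\in\Theta.$$
   Context: MDP: horizon $T$; state space $\mathcal S=\mathcal S_1\cup\dots\cup\mathcal S_T$ with $\mathcal S_t\subseteq\mathbb R^m$; action space $\mathcal A=\cup_{s\in\mathcal S}\mathcal A_s$ with $\mathcal A_s\subseteq\mathbb R^n$; transition kernels $P_t(\cdot|s,a)$; costs $C_t(s,a)\in\mathbb R$; initial state distribution $\rho$. A policy $\pi=(\pi_1,\dots,\pi_T)$ maps state $s$ at period $t$ to a feasible action $\pi_t(s)$; $s_1\sim\rho$ and $s_{t+1}\sim P_t(\cdot|s_t,\pi_t(s_t))$. $J(\pi)=\mathbb E[\sum_{t=1}^T C_t(s_t,\pi_t(s_t))]$. $\rho_t(\cdot|\pi)$ is the distribution of $s_t$ under $\pi$ (it depends only on $\pi_1,\dots,\pi_{t-1}$). Value functions: $V_{T+1}^\pi=0$, $Q_t^\pi(s,a)=C_t(s,a)+\mathbb E[V_{t+1}^\pi(s')\mid s'\sim P_t(\cdot|s,a)]$, $V_t^\pi(s)=Q_t^\pi(s,\pi_t(s))$. Optimal value functions satisfy $V^*_{T+1}=0$, $V_t^*(s)=\min_{\pi_t}Q_t^*(s,\pi_t(s))$, $Q_t^*(s,a)=C_t(s,a)+\mathbb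 E[V_{t+1}^*(s')\mid s'\sim P_t(\cdot|s,a)]$. Parameterized policies: $\theta=(\theta_1,\dots,\theta_T)$, $\theta_t\in\Theta_t\subseteq\mathbb R^d$ with $\Theta_t$ convex and compact; $\pi_\theta$ uses $\pi_t(\cdot|\theta_t)$ at period $t$; $l(\theta)=J(\pi_\theta)$; $\theta^*$ is a minimizer of $l$ over $\Theta$. Standing assumption: $\Pi_\Theta=\{\pi_\theta:\theta\in\Theta\}$ contains an optimal policy, and $V_t^{\pi_{\theta^*}}=V_t^*$, $Q_t^{\pi_{\theta^*}}=Q_t^*$ for all $t$. $\nabla l(\theta)$ is the vector of the partial gradients $\nabla_{\theta_t}l(\theta)$, $t=1,\dots,T$. In (1) and (2) the function is regarded as a function of $\theta_t$ alone, with the other components of $\theta$ (which determine $\rho_t(\cdot|\pi_\theta)$ and $Q_t^{\pi_\theta}(\cdot,\cdot)$) fixed. PŁK condition: for a convex compact set $\mathcal X\subseteq\mathbb R^n$ and differentiable $f$ with $f^*=\min_{\mathcal X}f$, $f$ satisfies the PŁK condition on $\mathcal X$ with constant $\mu>0$ if $f(x)-f^*\le\frac1{2\mu}\min_{g\in N_{\mathcal X}(x)}\|\nabla f(x)+g\|_2^2$ for all $x\in\mathcal X$, where $N_{\mathcal X}(x)=\{g:\langle g,x'-x\rangle\le0\ \forall x'\in\mathcal X\}$ is the normal cone (the subdifferential of the indicator function of $\mathcal X$).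
   Formalization: The constant M_g in (3) is additionally required to satisfy μ_Q ≤ M_g G T (any larger M_g also satisfies (3)); for small M_g the claim fails, e.g. T=1, l(x)=x²/2 on [-1,1]. Differentiability of l is meant in each block θ_t. *)

theory Defs
  imports "HOL-Probability.Probability"
begin

section \<open>Finite-horizon Markov decision processes\<close>

record ('s, 'a) mdp =
  horizon :: nat
  states  :: "nat \<Rightarrow> 's set"
  actions :: "'s \<Rightarrow> 'a set"
  kernel  :: "nat \<Rightarrow> 's \<Rightarrow> 'a \<Rightarrow> 's measure"
  cost    :: "nat \<Rightarrow> 's \<Rightarrow> 'a \<Rightarrow> real"
  init    :: "'s measure"

text \<open>A (deterministic, Markov) policy maps a period and a state to an action.\<close>

type_synonym ('s, 'a) policy = "nat \<Rightarrow> 's \<Rightarrow> 'a"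

definition state_space :: "('s::topological_space, 'a) mdp \<Rightarrow> nat \<Rightarrow> 's measure" where
  "state_space M t = restrict_space borel (states M t)"

definition feasible_pairs :: "('s, 'a) mdp \<Rightarrow> nat \<Rightarrow> ('s \<times> 'a) set" where
  "feasible_pairs M t = {(s, a). s \<in> states M t \<and> a \<in> actions M s}"

text \<open>
  Periods are \<open>1, \<dots>, T\<close>. The kernel of period \<open>T\<close> is unconstrained: it only occurs in
  integrals of the terminal value function, which is zero.
\<close>

definition is_mdp :: "('s::topological_space, 'a::topological_space) mdp \<Rightarrow> bool" where
  "is_mdp M \<longleftrightarrow>
     1 \<le> horizon M \<and>
     init M \<in> space (prob_algebra (state_space M 1)) \<and>
     (\<forall>t\<in>{1..<horizon M}. (\<lambda>(s, a). kernel M t s a)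
        \<in> restrict_space borel (feasible_pairs M t) \<rightarrow>\<^sub>M prob_algebra (state_space M (t + 1))) \<and>
     (\<forall>t\<in>{1..horizon M}. (\<lambda>(s, a). cost M t s a)
        \<in> borel_measurable (restrict_space borel (feasible_pairs M t)))"

text \<open>
  \<open>traj M \<pi> t\<close> is the joint law of \<open>(s\<^sub>1, \<dots>, s\<^sub>t)\<close> when \<open>s\<^sub>1\<close> follows the initial
  distribution and \<open>s\<^sub>i\<^sub>+\<^sub>1\<close> is drawn from the kernel at \<open>(s\<^sub>i, \<pi>\<^sub>i(s\<^sub>i))\<close>.
\<close>

definition traj_space :: "('s::topological_space, 'a) mdp \<Rightarrow> nat \<Rightarrow> (nat \<Rightarrow> 's) measure" where
  "traj_space M t = PiM {1..t} (state_space M)"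

primrec traj ::
  "('s::topological_space, 'a) mdp \<Rightarrow> ('s, 'a) policy \<Rightarrow> nat \<Rightarrow> (nat \<Rightarrow> 's) measure" where
  "traj M \<pi> 0 = return (traj_space M 0) (\<lambda>_. undefined)"
| "traj M \<pi> (Suc t) = traj M \<pi> t \<bind>
     (\<lambda>\<xi>. distr (if t = 0 then init M else kernel M t (\<xi> t) (\<pi> t (\<xi> t)))
                (traj_space M (Suc t)) (\<lambda>s. \<xi>(Suc t := s)))"

definition state_dist ::
  "('s::topological_space, 'a) mdp \<Rightarrow> ('s, 'a) policy \<Rightarrow> nat \<Rightarrow> 's measure" where
  "state_dist M \<pi> t = distr (traj M \<pi> (horizon M)) (state_space M t) (\<lambda>\<xi>. \<xi> t)"

definition J :: "('s::topological_space, 'a) mdp \<Rightarrow> ('s, 'a) policy \<Rightarrow> real" where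
  "J M \<pi> = (\<integral>\<xi>. (\<Sum>t=1..horizon M. cost M t (\<xi> t) (\<pi> t (\<xi> t))) \<partial>traj M \<pi> (horizon M))"

function V :: "('s, 'a) mdp \<Rightarrow> ('s, 'a) policy \<Rightarrow> nat \<Rightarrow> 's \<Rightarrow> real" where
  "V M \<pi> t = (\<lambda>s. if horizon M < t then 0
     else cost M t s (\<pi> t s) + (\<integral>s'. V M \<pi> (t + 1) s' \<partial>kernel M t s (\<pi> t s)))"
  by auto
termination
  by (relation "Wellfounded.measure (\<lambda>(M, \<pi>, t). Suc (horizon M) - t)") auto

declare V.simps [simp del]

definition Q :: "('s, 'a) mdp \<Rightarrow> ('s, 'a) policy \<Rightarrow> nat \<Rightarrow> 's \<Rightarrow> 'a \<Rightarrow> real" where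
  "Q M \<pi> t s a = cost M t s a + (\<integral>s'. V M \<pi> (t + 1) s' \<partial>kernel M t s a)"

lemma V_beyond: "horizon M < t \<Longrightarrow> V M \<pi> t s = 0"
  by (simp add: V.simps)

lemma V_eq_Q: "t \<le> horizon M \<Longrightarrow> V M \<pi> t s = Q M \<pi> t s (\<pi> t s)"
  unfolding Q_def by (subst V.simps) simp

text \<open>
  Measurable feasible policies for which the expectations occurring in \<open>J\<close>, \<open>V\<close> and \<open>Q\<close>
  exist. The Bochner integral of a non-integrable function is \<open>0\<close>, so this cannot be left implicit.
\<close>

definition admissible ::
  "('s::topological_space, 'a::topological_space) mdp \<Rightarrow> ('s, 'a) policy \<Rightarrow> bool" where
  "admissible M \<pi> \<longleftrightarrow>
     (\<forall>t\<in>{1..horizon M}.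
        \<pi> t \<in> state_space M t \<rightarrow>\<^sub>M borel \<and>
        (\<forall>s\<in>states M t. \<pi> t s \<in> actions M s) \<and>
        integrable (state_dist M \<pi> t) (\<lambda>s. cost M t s (\<pi> t s)) \<and>
        (\<forall>s\<in>states M t. \<forall>a\<in>actions M s. integrable (kernel M t s a) (V M \<pi> (t + 1))))"

text \<open>
  The optimality equations, with an attained minimum over the feasible actions. They are a
  predicate rather than a recursion through \<open>Inf\<close>, since \<open>Inf\<close> of a real set that is not
  bounded below is an arbitrary number.
\<close>

definition optimal_value_functions ::
  "('s, 'a) mdp \<Rightarrow> (nat \<Rightarrow> 's \<Rightarrow> real) \<Rightarrow> (nat \<Rightarrow> 's \<Rightarrow> 'a \<Rightarrow> real) \<Rightarrow> bool" where
  "optimal_value_functions M V' Q' \<longleftrightarrow>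
     (\<forall>s. V' (horizon M + 1) s = 0) \<and>
     (\<forall>t\<in>{1..horizon M}. \<forall>s\<in>states M t.
        (\<forall>a\<in>actions M s. Q' t s a = cost M t s a + (\<integral>s'. V' (t + 1) s' \<partial>kernel M t s a)) \<and>
        (\<exists>a\<in>actions M s. V' t s = Q' t s a) \<and>
        (\<forall>a\<in>actions M s. V' t s \<le> Q' t s a))"


section \<open>Gradients, normal cones and the PLK condition\<close>

text \<open>
  Gradient of a function that is only given on a convex set \<open>X\<close>. If \<open>X\<close> has an interior point,
  the span below is the whole space and this is the usual gradient, one-sided at the boundary.
  Otherwise a derivative within \<open>X\<close> determines the gradient only up to vectors orthogonal to
  the affine hull of \<open>X\<close>; the representative parallel to the affine hull is taken. Adding an
  orthogonal vector would not affect the PLK condition, because the normal cone is invariant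
  under such translations.
\<close>

definition gradient_on :: "'p::euclidean_space set \<Rightarrow> ('p \<Rightarrow> real) \<Rightarrow> 'p \<Rightarrow> 'p" where
  "gradient_on X f x = (THE v. v \<in> span ((\<lambda>y. y - x) ` X) \<and>
     (f has_derivative (\<lambda>h. v \<bullet> h)) (at x within X))"

definition normal_cone :: "'p::euclidean_space set \<Rightarrow> 'p \<Rightarrow> 'p set" where
  "normal_cone X x = {g. \<forall>y\<in>X. g \<bullet> (y - x) \<le> 0}"

text \<open>
  For compact convex nonempty \<open>X\<close> both infima are attained: \<open>f\<close> is continuous on \<open>X\<close>, and the
  normal cone is closed and nonempty.
\<close>

definition PLK :: "'p::euclidean_space set \<Rightarrow> ('p \<Rightarrow> real) \<Rightarrow> real \<Rightarrow> bool" where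
  "PLK X f \<mu> \<longleftrightarrow> 0 < \<mu> \<and> f differentiable_on X \<and>
     (\<forall>x\<in>X. f x - (INF y\<in>X. f y) \<le>
        1 / (2 * \<mu>) * (INF g\<in>normal_cone X x. (norm (gradient_on X f x + g))\<^sup>2))"

text \<open>
  The same notions on a product \<open>X\<^sub>1 \<times> \<dots> \<times> X\<^sub>T\<close>, whose elements are functions on
  \<open>{1..T}\<close>, with the Euclidean inner product and norm of the concatenated vector. The gradient
  is the vector of the partial gradients.
\<close>

definition partial_gradient ::
  "(nat \<Rightarrow> 'p::euclidean_space set) \<Rightarrow> ((nat \<Rightarrow> 'p) \<Rightarrow> real) \<Rightarrow> nat \<Rightarrow> (nat \<Rightarrow> 'p) \<Rightarrow> 'p" where
  "partial_gradient X f t x = gradient_on (X t) (\<lambda>y. f (x(t := y))) (x t)"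

definition normal_cone_prod ::
  "nat \<Rightarrow> (nat \<Rightarrow> 'p::euclidean_space set) \<Rightarrow> (nat \<Rightarrow> 'p) \<Rightarrow> (nat \<Rightarrow> 'p) set" where
  "normal_cone_prod T X x =
     {g. \<forall>y\<in>PiE {1..T} X. (\<Sum>t=1..T. g t \<bullet> (y t - x t)) \<le> 0}"

definition stationarity_gap ::
  "nat \<Rightarrow> (nat \<Rightarrow> 'p::euclidean_space set) \<Rightarrow> ((nat \<Rightarrow> 'p) \<Rightarrow> real) \<Rightarrow> (nat \<Rightarrow> 'p) \<Rightarrow> real" where
  "stationarity_gap T X f x =
     (INF g\<in>normal_cone_prod T X x. \<Sum>t=1..T. (norm (partial_gradient X f t x + g t))\<^sup>2)"

definition PLK_prod ::
  "nat \<Rightarrow> (nat \<Rightarrow> 'p::euclidean_space set) \<Rightarrow> ((nat \<Rightarrow> 'p) \<Rightarrow> real) \<Rightarrow> real \<Rightarrow> bool" where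
  "PLK_prod T X f \<mu> \<longleftrightarrow> 0 < \<mu> \<and>
     (\<forall>x\<in>PiE {1..T} X. \<forall>t\<in>{1..T}. (\<lambda>y. f (x(t := y))) differentiable_on X t) \<and>
     (\<forall>x\<in>PiE {1..T} X. f x - (INF y\<in>PiE {1..T} X. f y) \<le>
        1 / (2 * \<mu>) * stationarity_gap T X f x)"


section \<open>Parameterized policies\<close>

definition policy_of :: "(nat \<Rightarrow> 'p \<Rightarrow> 's \<Rightarrow> 'a) \<Rightarrow> (nat \<Rightarrow> 'p) \<Rightarrow> ('s, 'a) policy" where
  "policy_of pol \<theta> t = pol t (\<theta> t)"

definition objective ::
  "('s::topological_space, 'a) mdp \<Rightarrow> (nat \<Rightarrow> 'p \<Rightarrow> 's \<Rightarrow> 'a) \<Rightarrow> (nat \<Rightarrow> 'p) \<Rightarrow> real" where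
  "objective M pol \<theta> = J M (policy_of pol \<theta>)"

text \<open>
  \<open>expected_Q M pol \<theta> \<theta>' t x\<close> is the expectation of \<open>Q\<^sub>t(s, \<pi>\<^sub>t(s | x))\<close>, where \<open>Q\<^sub>t\<close> belongs
  to the policy with parameter \<open>\<theta>'\<close> and \<open>s\<close> is the period-\<open>t\<close> state under the policy with
  parameter \<open>\<theta>\<close>.
\<close>

definition expected_Q ::
  "('s::topological_space, 'a) mdp \<Rightarrow> (nat \<Rightarrow> 'p \<Rightarrow> 's \<Rightarrow> 'a) \<Rightarrow>
     (nat \<Rightarrow> 'p) \<Rightarrow> (nat \<Rightarrow> 'p) \<Rightarrow> nat \<Rightarrow> 'p \<Rightarrow> real" where
  "expected_Q M pol \<theta> \<theta>' t x =
     (\<integral>s. Q M (policy_of pol \<theta>') t s (pol t x s) \<partial>state_dist M (policy_of pol \<theta>) t)"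

text \<open>\<open>join_params k \<theta> \<theta>'\<close> is \<open>(\<theta>\<^sub>1, \<dots>, \<theta>\<^sub>k, \<theta>'\<^sub>k\<^sub>+\<^sub>1, \<dots>, \<theta>'\<^sub>T)\<close>.\<close>

definition join_params :: "nat \<Rightarrow> (nat \<Rightarrow> 'p) \<Rightarrow> (nat \<Rightarrow> 'p) \<Rightarrow> nat \<Rightarrow> 'p" where
  "join_params k \<theta> \<theta>' i = (if i \<le> k then \<theta> i else \<theta>' i)"

end

theory Submission
  imports Defs
begin

text \<open>
  Write \<open>\<delta>\<^sub>k\<close> for the change of the objective when \<open>\<theta>\<^sub>k\<close> replaces \<open>\<theta>\<^sup>*\<^sub>k\<close> between
  \<open>(\<theta>\<^sub>1, \<dots>, \<theta>\<^sub>k\<^sub>-\<^sub>1)\<close> and \<open>(\<theta>\<^sup>*\<^sub>k\<^sub>+\<^sub>1, \<dots>, \<theta>\<^sup>*\<^sub>T)\<close>. This is the suboptimality of \<open>\<theta>\<^sub>k\<close> for the expected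
  optimal Q-value of period \<open>k\<close>, so \<open>\<delta>\<^sub>k \<ge> 0\<close>, and the sum of all \<open>\<delta>\<^sub>k\<close> is \<open>l(\<theta>) - l(\<theta>\<^sup>*)\<close>.
  For a normal vector \<open>g\<close> put \<open>a\<^sub>t = \<parallel>\<nabla>\<^sub>t l(\<theta>) + g\<^sub>t\<parallel>\<close>. The PLK condition of period \<open>t\<close>, with the
  gradient at \<open>(\<theta>\<^sub>1, \<dots>, \<theta>\<^sub>t, \<theta>\<^sup>*\<^sub>t\<^sub>+\<^sub>1, \<dots>)\<close> compared to the one at \<open>\<theta>\<close> through the decomposition
  inequality, gives \<open>2\<mu>\<delta>\<^sub>t \<le> (a\<^sub>t + M\<^sub>g (\<delta>\<^sub>t\<^sub>+\<^sub>1 + \<dots> + \<delta>\<^sub>T))\<^sup>2\<close>, and with the normal vector \<open>0\<close> it gives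
  \<open>2\<mu>\<delta>\<^sub>t \<le> G\<^sup>2\<close>. As long as the tail sums stay below \<open>\<mu> / (M\<^sub>g\<^sup>2 T)\<close>, each of the \<open>T\<close> steps
  multiplies them by at most \<open>1 + 1/T\<close> and adds at most \<open>a\<^sub>t\<^sup>2 / \<mu>\<close>. If they ever exceed this threshold, then the sum
  of the \<open>a\<^sub>t\<^sup>2\<close> is so large that the bound \<open>T G\<^sup>2 / (2\<mu>)\<close> suffices.
\<close>

subsection \<open>The recursive inequality\<close>

text \<open>With \<open>u = r - 1\<close> the exponents 3/4, -u/4 and r/4 add up to 1, so it
  suffices that exp(3/4) is at least 2 and that (1 + u) exp(-u/4) is at least (1 + u)(1 - u/4) = 1 +
  u (3 - u)/4, hence at least 1. This fits the factor \<open>exp (r / 4)\<close> from the case of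
  small \<open>r\<close> under the target factor e r / 2.\<close>

lemma growth_constant:
  assumes "1 \<le> (r::real)" "r \<le> 2"
  shows "2 * exp (r / 4) \<le> exp 1 * r"
proof -
  define u where "u = r - 1"
  have u: "0 \<le> u" "u \<le> 1" using assms by (auto simp: u_def)
  have "2 \<le> exp (3 / 4 :: real)"
    using exp_lower_Taylor_quadratic[of "3 / 4 :: real"] by (simp add: power2_eq_square)
  moreover have "1 \<le> r * exp (- (u / 4))"
  proof -
    have "1 \<le> (1 + u) * (1 - u / 4)"
      using mult_nonneg_nonneg[of u "3 - u"] u by (simp add: algebra_simps)
    also have "\<dots> \<le> (1 + u) * exp (- (u / 4))"
      using exp_ge_add_one_self[of "- (u / 4)"] u by (intro mult_left_mono) auto
    finally show ?thesis by (simp add: u_def)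
  qed
  ultimately have "2 * 1 \<le> exp (3 / 4) * (r * exp (- (u / 4)))"
    by (intro mult_mono) auto
  then have "2 * 1 * exp (r / 4) \<le> exp (3 / 4) * (r * exp (- (u / 4))) * exp (r / 4)"
    by (intro mult_right_mono) auto
  also have "\<dots> = r * (exp (3 / 4) * exp (- (u / 4)) * exp (r / 4))" by (simp add: ac_simps)
  also have "exp (3 / 4) * exp (- (u / 4)) * exp (r / 4) = exp 1"
    by (simp add: u_def flip: exp_add) (simp add: field_simps)
  finally show ?thesis by (simp add: mult.commute)
qed

text \<open>Periods are counted backwards: \<open>y n\<close> stands for the loss of period
  \<open>T - n\<close>, so the sum over \<open>i < n\<close> collects the losses of all later
  periods. In terms of r = (C G T / \<mu>)^2, which \<open>norm\<close> makes at least 1, the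
  constant to reach is e r / (2 \<mu>).\<close>

lemma recursive_quadratic_bound:
  fixes y a :: "nat \<Rightarrow> real" and T :: nat and \<mu> C G :: real
  assumes pos: "0 < \<mu>" "0 < C" "0 < G" and norm: "\<mu> \<le> C * G * real T"
    and y: "\<And>n. n < T \<Longrightarrow> 0 \<le> y n"
    and crude: "\<And>n. n < T \<Longrightarrow> 2 * \<mu> * y n \<le> G\<^sup>2"
    and rec: "\<And>n. n < T \<Longrightarrow> 2 * \<mu> * y n \<le> (a n + C * (\<Sum>i<n. y i))\<^sup>2"
  shows "(\<Sum>i<T. y i) \<le> exp 1 * C\<^sup>2 * G\<^sup>2 * (real T)\<^sup>2 / (2 * \<mu> ^ 3) * (\<Sum>i<T. (a i)\<^sup>2)"
proof -
  define Y where "Y n = (\<Sum>i<n. y i)" for n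
  define A where "A n = (\<Sum>i<n. (a i)\<^sup>2)" for n
  define r where "r = (C * G * real T / \<mu>)\<^sup>2"
  have T: "0 < T" using norm pos by (cases T) auto
  have "1 \<le> C * G * real T / \<mu>" using norm pos by simp
  then have r1: "1 \<le> r" by (simp add: r_def one_le_power)
  have const: "exp 1 * C\<^sup>2 * G\<^sup>2 * (real T)\<^sup>2 / (2 * \<mu> ^ 3) = exp 1 * r / (2 * \<mu>)"
    using pos by (simp add: r_def field_simps power2_eq_square power3_eq_cube)
  have Y0: "0 \<le> Y n" if "n \<le> T" for n
    unfolding Y_def using that y by (intro sum_nonneg) auto
  have A0: "0 \<le> A n" for n unfolding A_def by (intro sum_nonneg) auto
  have A_mono: "A n \<le> A m" if "n \<le> m" for n m
    unfolding A_def using that by (intro sum_mono2) auto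
  have Y_crude: "Y n \<le> real n * (G\<^sup>2 / (2 * \<mu>))" if "n \<le> T" for n
  proof -
    have "y i \<le> G\<^sup>2 / (2 * \<mu>)" if "i < n" for i
      using crude[of i] that \<open>n \<le> T\<close> pos by (simp add: field_simps)
    then show ?thesis unfolding Y_def using sum_bounded_above[of "{..<n}" y "G\<^sup>2 / (2 * \<mu>)"] by auto
  qed
  \<comment> \<open>Splitting the square costs a factor 2, which cancels the one in
    \<open>2 * \<mu> * y n\<close>; what remains is a recursion with growth factor 1 + C^2 Y /
    \<mu>.\<close>
  have step: "Y (Suc n) \<le> Y n * (1 + C\<^sup>2 * Y n / \<mu>) + (a n)\<^sup>2 / \<mu>" if "n < T" for n
  proof -
    have "2 * \<mu> * y n \<le> (a n + C * Y n)\<^sup>2" using rec[OF that] by (simp add: Y_def)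
    also have "\<dots> \<le> 2 * ((a n)\<^sup>2 + (C * Y n)\<^sup>2)"
      using sum_squares_bound[of "a n" "C * Y n"] by (simp add: power2_sum)
    finally have "y n \<le> ((a n)\<^sup>2 + (C * Y n)\<^sup>2) / \<mu>" using pos by (simp add: field_simps)
    then show ?thesis by (simp add: Y_def field_simps power2_eq_square add_divide_distrib)
  qed
  \<comment> \<open>A discrete Gronwall argument: \<open>B\<close> is any majorant of the
    accumulated growth factors. It stays at least 1, so the new term
    \<open>(a k)\<^sup>2 / \<mu>\<close> may carry the weight \<open>B (Suc k)\<close> too.\<close>
  have propagate: "Y n \<le> B n / \<mu> * A n"
    if n: "n \<le> T" and B0: "1 \<le> B 0"
      and B: "\<And>k. k < n \<Longrightarrow> B k * (1 + C\<^sup>2 * Y k / \<mu>) \<le> B (Suc k)"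
    for B :: "nat \<Rightarrow> real" and n
  proof -
    have "1 \<le> B k \<and> Y k \<le> B k / \<mu> * A k" if "k \<le> n" for k
      using that
    proof (induction k)
      case 0
      then show ?case using B0 by (simp add: Y_def A_def)
    next
      case (Suc k)
      then have IH: "1 \<le> B k" "Y k \<le> B k / \<mu> * A k" and k: "k < T" using n by auto
      let ?w = "1 + C\<^sup>2 * Y k / \<mu>"
      have w: "1 \<le> ?w" using Y0[of k] k pos by simp
      have "1 * 1 \<le> B k * ?w" using IH w by (intro mult_mono) auto
      then have B1: "1 \<le> B (Suc k)" using B[of k] Suc.prems by simp
      have "Y (Suc k) \<le> Y k * ?w + (a k)\<^sup>2 / \<mu>" using step[OF k] .
      also have "\<dots> \<le> (B k / \<mu> * A k) * ?w + (a k)\<^sup>2 / \<mu>"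
        using IH w by (intro add_right_mono mult_right_mono) auto
      also have "\<dots> = (B k * ?w) * (A k / \<mu>) + (a k)\<^sup>2 / \<mu>" by simp
      also have "\<dots> \<le> B (Suc k) * (A k / \<mu>) + B (Suc k) * ((a k)\<^sup>2 / \<mu>)"
        using B[of k] Suc.prems A0[of k] pos B1 mult_right_mono[OF B1, of "(a k)\<^sup>2 / \<mu>"]
        by (intro add_mono mult_right_mono) auto
      also have "\<dots> = B (Suc k) / \<mu> * A (Suc k)"
        by (simp add: A_def algebra_simps add_divide_distrib)
      finally show ?case using B1 by simp
    qed
    then show ?thesis by blast
  qed
  have "Y T \<le> exp 1 * r / (2 * \<mu>) * A T"
  proof (cases "r \<le> 2")
    case True
    \<comment> \<open>Below the threshold, the argument for \<open>r > 2\<close> bounds \<open>Y T\<close> by \<open>exp 1 / \<mu> * A T\<close> only. For small \<open>r\<close>,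
      the crude bound on \<open>Y k\<close>, which is linear in \<open>k\<close>, controls the growth factors instead.\<close>
    define c where "c = (C * G / \<mu>)\<^sup>2 / 4"
    have c0: "0 \<le> c" by (simp add: c_def)
    \<comment> \<open>The majorant is \<open>exp (c * (real k)\<^sup>2)\<close>: the crude bound
      makes the excess of the growth factor over 1 at most 2 c k, and c (2 k + 1) is the increment
      of c k^2.\<close>
    have "Y T \<le> exp (c * (real T)\<^sup>2) / \<mu> * A T"
    proof (rule propagate)
      fix k assume k: "k < T"
      have "C\<^sup>2 * Y k / \<mu> \<le> C\<^sup>2 * (real k * (G\<^sup>2 / (2 * \<mu>))) / \<mu>"
        using Y_crude[of k] k pos by (intro divide_right_mono mult_left_mono) auto
      also have "\<dots> = c * (2 * real k)"
        using pos by (simp add: c_def field_simps power2_eq_square)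
      also have "\<dots> \<le> c * (2 * real k + 1)" using c0 by (intro mult_left_mono) auto
      finally have "1 + C\<^sup>2 * Y k / \<mu> \<le> exp (c * (2 * real k + 1))"
        using exp_ge_add_one_self[of "c * (2 * real k + 1)"] by linarith
      then have "exp (c * (real k)\<^sup>2) * (1 + C\<^sup>2 * Y k / \<mu>) \<le> exp (c * (real k)\<^sup>2) * exp (c * (2 * real k + 1))"
        by (intro mult_left_mono) auto
      also have "\<dots> = exp (c * (real (Suc k))\<^sup>2)"
        by (simp add: power2_eq_square algebra_simps flip: exp_add)
      finally show "exp (c * (real k)\<^sup>2) * (1 + C\<^sup>2 * Y k / \<mu>) \<le> exp (c * (real (Suc k))\<^sup>2)" .
    qed auto
    also have "c * (real T)\<^sup>2 = r / 4"
      using pos by (simp add: c_def r_def field_simps)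
    also have "exp (r / 4) / \<mu> * A T \<le> exp 1 * r / (2 * \<mu>) * A T"
      using growth_constant[OF r1 True] pos A0 by (intro mult_right_mono) (auto simp: field_simps)
    finally show ?thesis .
  next
    case False
    \<comment> \<open>Two properties fix this threshold: up to it each growth factor is at most 1 +
      1/T, and the crude bound T G^2 / (2 \<mu>) on the total equals r/2 times it.\<close>
    define \<tau> where "\<tau> = \<mu> / (C\<^sup>2 * real T)"
    have below: "Y n \<le> exp 1 / \<mu> * A n" if n: "n \<le> T" and small: "\<And>k. k < n \<Longrightarrow> Y k \<le> \<tau>" for n
    proof -
      have "Y n \<le> exp (real n / real T) / \<mu> * A n"
      proof (rule propagate[OF n])
        fix k assume k: "k < n"
        have "C\<^sup>2 * Y k / \<mu> \<le> C\<^sup>2 * \<tau> / \<mu>"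
          using small[OF k] pos by (intro divide_right_mono mult_left_mono) auto
        also have "\<dots> = 1 / real T" using pos T by (simp add: \<tau>_def field_simps)
        finally have "1 + C\<^sup>2 * Y k / \<mu> \<le> exp (1 / real T)"
          using exp_ge_add_one_self[of "1 / real T"] by linarith
        then have "exp (real k / real T) * (1 + C\<^sup>2 * Y k / \<mu>) \<le> exp (real k / real T) * exp (1 / real T)"
          by (intro mult_left_mono) auto
        also have "\<dots> = exp (real (Suc k) / real T)"
          by (simp add: add_divide_distrib flip: exp_add)
        finally show "exp (real k / real T) * (1 + C\<^sup>2 * Y k / \<mu>) \<le> exp (real (Suc k) / real T)" .
      qed auto
      also have "\<dots> \<le> exp 1 / \<mu> * A n"
        using n T pos A0 by (intro mult_right_mono divide_right_mono) auto
      finally show ?thesis .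
    qed
    show ?thesis
    proof (cases "\<forall>k<T. Y k \<le> \<tau>")
      case True
      then have "Y T \<le> exp 1 / \<mu> * A T" by (intro below) auto
      \<comment> \<open>Here \<open>r > 2\<close> pays for the 2 in the denominator of the target
        constant.\<close>
      also have "\<dots> \<le> exp 1 * r / (2 * \<mu>) * A T"
        using \<open>\<not> r \<le> 2\<close> pos A0 by (intro mult_right_mono) (auto simp: field_simps)
      finally show ?thesis .
    next
      case cross: False
      define n where "n = (LEAST k. k < T \<and> \<not> Y k \<le> \<tau>)"
      have n: "n < T" "\<tau> < Y n"
        using LeastI_ex[of "\<lambda>k. k < T \<and> \<not> Y k \<le> \<tau>"] cross unfolding n_def by auto
      have least: "Y k \<le> \<tau>" if "k < n" for k
        using not_less_Least[of k "\<lambda>k. k < T \<and> \<not> Y k \<le> \<tau>"] that n unfolding n_def by auto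
      \<comment> \<open>\<open>below\<close> asks for smallness strictly before \<open>n\<close>, so
        it still applies at the first crossing and there bounds \<open>A n\<close> from
        below.\<close>
      have "\<tau> \<le> exp 1 / \<mu> * A n" using below[of n] n least by fastforce
      also have "\<dots> \<le> exp 1 / \<mu> * A T" using A_mono[of n T] n pos by (intro mult_left_mono) auto
      finally have \<tau>: "\<tau> \<le> exp 1 / \<mu> * A T" .
      have "Y T \<le> real T * (G\<^sup>2 / (2 * \<mu>))" using Y_crude by simp
      also have "\<dots> = r / 2 * \<tau>"
        using pos T by (simp add: r_def \<tau>_def field_simps power2_eq_square)
      also have "\<dots> \<le> r / 2 * (exp 1 / \<mu> * A T)"
        using \<tau> r1 by (intro mult_left_mono) auto
      also have "\<dots> = exp 1 * r / (2 * \<mu>) * A T" by simp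
      finally show ?thesis .
    qed
  qed
  then show ?thesis unfolding const by (simp add: Y_def A_def)
qed

subsection \<open>State distributions and value functions\<close>

text \<open>The tower property holds for nonnegative integrals without integrability;
  \<open>int_N\<close> identifies each inner one with the Bochner integral, which could otherwise be
  the default 0.\<close>

lemma has_bochner_integral_bind_nonneg:
  fixes f :: "'b \<Rightarrow> real"
  assumes N: "N \<in> M \<rightarrow>\<^sub>M subprob_algebra K" and f: "f \<in> borel_measurable K" and f0: "\<And>y. 0 \<le> f y"
    and int: "integrable (M \<bind> N) f" and int_N: "\<And>x. x \<in> space M \<Longrightarrow> integrable (N x) f"
  shows "has_bochner_integral M (\<lambda>x. \<integral>y. f y \<partial>N x) (\<integral>y. f y \<partial>(M \<bind> N))"
proof (rule has_bochner_integral_nn_integral)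
  show "(\<lambda>x. \<integral>y. f y \<partial>N x) \<in> borel_measurable M"
    using measurable_compose[OF N integral_measurable_subprob_algebra[OF f]] .
  have "(\<integral>\<^sup>+x. ennreal (\<integral>y. f y \<partial>N x) \<partial>M) = (\<integral>\<^sup>+x. \<integral>\<^sup>+y. ennreal (f y) \<partial>N x \<partial>M)"
    using int_N f0 by (intro nn_integral_cong nn_integral_eq_integral[symmetric]) auto
  also have "\<dots> = (\<integral>\<^sup>+y. ennreal (f y) \<partial>(M \<bind> N))"
    using f by (intro nn_integral_bind[OF _ N, symmetric]) auto
  also have "\<dots> = ennreal (\<integral>y. f y \<partial>(M \<bind> N))"
    using int f0 by (intro nn_integral_eq_integral) auto
  finally show "(\<integral>\<^sup>+x. ennreal (\<integral>y. f y \<partial>N x) \<partial>M) = ennreal (\<integral>y. f y \<partial>(M \<bind> N))" .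
qed (use f0 in auto)

text \<open>Positive and negative parts reduce this to the nonnegative case.\<close>

lemma has_bochner_integral_bind:
  fixes f :: "'b \<Rightarrow> real"
  assumes N: "N \<in> M \<rightarrow>\<^sub>M subprob_algebra K" and f: "f \<in> borel_measurable K"
    and int: "integrable (M \<bind> N) f" and int_N: "\<And>x. x \<in> space M \<Longrightarrow> integrable (N x) f"
  shows "has_bochner_integral M (\<lambda>x. \<integral>y. f y \<partial>N x) (\<integral>y. f y \<partial>(M \<bind> N))"
proof -
  let ?p = "\<lambda>y. max 0 (f y)" and ?n = "\<lambda>y. max 0 (- f y)"
  have split: "(\<integral>y. f y \<partial>L) = (\<integral>y. ?p y \<partial>L) - (\<integral>y. ?n y \<partial>L)" if "integrable L f" for L
  proof -
    have "(\<integral>y. f y \<partial>L) = (\<integral>y. ?p y - ?n y \<partial>L)"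
      by (intro Bochner_Integration.integral_cong) auto
    also have "\<dots> = (\<integral>y. ?p y \<partial>L) - (\<integral>y. ?n y \<partial>L)"
      using that by (intro Bochner_Integration.integral_diff) auto
    finally show ?thesis .
  qed
  have "has_bochner_integral M (\<lambda>x. (\<integral>y. ?p y \<partial>N x) - (\<integral>y. ?n y \<partial>N x))
      ((\<integral>y. ?p y \<partial>(M \<bind> N)) - (\<integral>y. ?n y \<partial>(M \<bind> N)))"
    using f int int_N by (intro has_bochner_integral_diff has_bochner_integral_bind_nonneg[OF N]) auto
  then show ?thesis
    by (subst has_bochner_integral_cong[OF refl _ refl]) (auto simp: split int_N split[OF int])
qed

section \<open>Measurability along an admissible policy\<close>

lemma space_state_space [simp]: "space (state_space M t) = states M t"
  by (simp add: state_space_def space_restrict_space)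

text \<open>Kernels and costs are measurable jointly and on feasible pairs only; composition with
  this map makes them measurable in the state. Second countability lets a pair of Borel maps be
  Borel.\<close>

lemma measurable_policy_pair:
  fixes M :: "('s::second_countable_topology, 'a::second_countable_topology) mdp"
  assumes "admissible M \<pi>" "t \<in> {1..horizon M}"
  shows "(\<lambda>s. (s, \<pi> t s)) \<in> state_space M t \<rightarrow>\<^sub>M restrict_space borel (feasible_pairs M t)"
proof (rule measurable_restrict_space2)
  have "(\<lambda>s. s) \<in> state_space M t \<rightarrow>\<^sub>M borel"
    unfolding state_space_def by (rule measurable_restrict_space1) simp
  moreover have "\<pi> t \<in> state_space M t \<rightarrow>\<^sub>M borel"
    using assms by (auto simp: admissible_def)
  ultimately show "(\<lambda>s. (s, \<pi> t s)) \<in> state_space M t \<rightarrow>\<^sub>M borel"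
    by (rule borel_measurable_Pair)
  show "(\<lambda>s. (s, \<pi> t s)) \<in> space (state_space M t) \<rightarrow> feasible_pairs M t"
    using assms by (auto simp: admissible_def feasible_pairs_def)
qed

lemma measurable_kernel_policy:
  fixes M :: "('s::second_countable_topology, 'a::second_countable_topology) mdp"
  assumes "is_mdp M" "admissible M \<pi>" "1 \<le> t" "t < horizon M"
  shows "(\<lambda>s. kernel M t s (\<pi> t s)) \<in> state_space M t \<rightarrow>\<^sub>M prob_algebra (state_space M (Suc t))"
proof -
  have "(\<lambda>(s, a). kernel M t s a)
      \<in> restrict_space borel (feasible_pairs M t) \<rightarrow>\<^sub>M prob_algebra (state_space M (Suc t))"
    using assms by (auto simp: is_mdp_def)
  from measurable_compose[OF measurable_policy_pair this, of \<pi>] assms show ?thesis by simp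
qed

lemma measurable_cost_policy:
  fixes M :: "('s::second_countable_topology, 'a::second_countable_topology) mdp"
  assumes "is_mdp M" "admissible M \<pi>" "t \<in> {1..horizon M}"
  shows "(\<lambda>s. cost M t s (\<pi> t s)) \<in> borel_measurable (state_space M t)"
proof -
  have "(\<lambda>(s, a). cost M t s a) \<in> borel_measurable (restrict_space borel (feasible_pairs M t))"
    using assms by (auto simp: is_mdp_def)
  from measurable_compose[OF measurable_policy_pair this, of \<pi>] assms show ?thesis by simp
qed

lemma measurable_V:
  fixes M :: "('s::second_countable_topology, 'a::second_countable_topology) mdp"
  assumes "is_mdp M" "admissible M \<pi>" "1 \<le> t"
  shows "V M \<pi> t \<in> borel_measurable (state_space M t)"
proof (cases "t \<le> Suc (horizon M)")
  case True
  then show ?thesis using \<open>1 \<le> t\<close>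
  proof (induction t rule: inc_induct)
    case base
    then show ?case by (simp add: V.simps)
  next
    case (step t)
    have IH: "V M \<pi> (Suc t) \<in> borel_measurable (state_space M (Suc t))"
      using step by auto
    have t: "t \<in> {1..horizon M}" using step by auto
    have "(\<lambda>s. \<integral>s'. V M \<pi> (Suc t) s' \<partial>kernel M t s (\<pi> t s)) \<in> borel_measurable (state_space M t)"
    \<comment> \<open>The kernel of the last period carries no measurability hypothesis, but the
      function integrated against it is zero.\<close>
    proof (cases "t = horizon M")
      case True
      then show ?thesis by (simp add: V_beyond)
    next
      case False
      then show ?thesis
        using t assms by (intro measurable_compose[OF measurable_prob_algebraD[OF measurable_kernel_policy]
              integral_measurable_subprob_algebra[OF IH]]) auto
    qed
    moreover have "(\<lambda>s. cost M t s (\<pi> t s)) \<in> borel_measurable (state_space M t)"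
      using measurable_cost_policy[OF assms(1,2) t] .
    ultimately have "(\<lambda>s. cost M t s (\<pi> t s) + (\<integral>s'. V M \<pi> (Suc t) s' \<partial>kernel M t s (\<pi> t s)))
        \<in> borel_measurable (state_space M t)"
      by (intro borel_measurable_add)
    moreover have "V M \<pi> t = (\<lambda>s. cost M t s (\<pi> t s) + (\<integral>s'. V M \<pi> (Suc t) s' \<partial>kernel M t s (\<pi> t s)))"
      using t by (subst V.simps) auto
    ultimately show ?case by simp
  qed
next
  case False
  then show ?thesis by (simp add: V.simps)
qed

lemma V_cong:
  assumes "\<And>i. t \<le> i \<Longrightarrow> i \<le> horizon M \<Longrightarrow> \<pi> i = \<pi>' i"
  shows "V M \<pi> t = V M \<pi>' t"
proof (cases "t \<le> Suc (horizon M)")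
  case True
  then show ?thesis using assms
  proof (induction t rule: inc_induct)
    case base
    then show ?case by (simp add: V.simps)
  next
    case (step t)
    have "V M \<pi> (Suc t) = V M \<pi>' (Suc t)" using step by auto
    moreover have "\<pi> t = \<pi>' t" using step by auto
    ultimately show ?case by (subst (1 2) V.simps) auto
  qed
next
  case False
  then show ?thesis by (simp add: V.simps)
qed

text \<open>The inequality \<open>t < i\<close> is strict because the action of period
  \<open>t\<close> is an argument of \<open>Q\<close>; hence the parameter of period
  \<open>t\<close> can vary while \<open>Q\<close> stays fixed.\<close>

lemma Q_cong:
  assumes "\<And>i. t < i \<Longrightarrow> i \<le> horizon M \<Longrightarrow> \<pi> i = \<pi>' i"
  shows "Q M \<pi> t = Q M \<pi>' t"
  using V_cong[of "t + 1" M \<pi> \<pi>'] assms by (auto simp: Q_def fun_eq_iff)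

section \<open>The trajectory law, its marginals and expected costs\<close>

lemma measurable_trajectory_step:
  fixes M :: "('s::second_countable_topology, 'a::second_countable_topology) mdp"
  assumes "is_mdp M" "admissible M \<pi>" "t < horizon M"
  shows "(\<lambda>\<xi>. distr (if t = 0 then init M else kernel M t (\<xi> t) (\<pi> t (\<xi> t)))
      (traj_space M (Suc t)) (\<lambda>s. \<xi>(Suc t := s))) \<in> traj_space M t \<rightarrow>\<^sub>M prob_algebra (traj_space M (Suc t))"
    and "(\<lambda>\<xi>. if t = 0 then init M else kernel M t (\<xi> t) (\<pi> t (\<xi> t)))
      \<in> traj_space M t \<rightarrow>\<^sub>M prob_algebra (state_space M (Suc t))"
    and "\<xi> \<in> space (traj_space M t) \<Longrightarrow>
      (\<lambda>s. \<xi>(Suc t := s)) \<in> state_space M (Suc t) \<rightarrow>\<^sub>M traj_space M (Suc t)"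
proof -
  show kernel: "(\<lambda>\<xi>. if t = 0 then init M else kernel M t (\<xi> t) (\<pi> t (\<xi> t)))
      \<in> traj_space M t \<rightarrow>\<^sub>M prob_algebra (state_space M (Suc t))"
  proof (cases "t = 0")
    case True
    then show ?thesis using assms by (auto simp: is_mdp_def)
  next
    case False
    have "(\<lambda>\<xi>. \<xi> t) \<in> traj_space M t \<rightarrow>\<^sub>M state_space M t"
      unfolding traj_space_def using False by (intro measurable_component_singleton) auto
    from measurable_compose[OF this measurable_kernel_policy[of M \<pi> t]] show ?thesis
      using False assms by auto
  qed
  have upd: "(\<lambda>(\<xi>, s). \<xi>(Suc t := s)) \<in> traj_space M t \<Otimes>\<^sub>M state_space M (Suc t) \<rightarrow>\<^sub>M traj_space M (Suc t)"
    using measurable_add_dim[of "Suc t" "{1..t}" "state_space M"]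
    by (simp add: traj_space_def atLeastAtMostSuc_conv)
  show "\<xi> \<in> space (traj_space M t) \<Longrightarrow>
      (\<lambda>s. \<xi>(Suc t := s)) \<in> state_space M (Suc t) \<rightarrow>\<^sub>M traj_space M (Suc t)"
    using measurable_Pair2[OF upd] by simp
  show "(\<lambda>\<xi>. distr (if t = 0 then init M else kernel M t (\<xi> t) (\<pi> t (\<xi> t)))
      (traj_space M (Suc t)) (\<lambda>s. \<xi>(Suc t := s))) \<in> traj_space M t \<rightarrow>\<^sub>M prob_algebra (traj_space M (Suc t))"
    by (rule measurable_distr_prob_space2[OF kernel upd])
qed

lemma traj_in_prob_algebra:
  fixes M :: "('s::second_countable_topology, 'a::second_countable_topology) mdp"
  assumes "is_mdp M" "admissible M \<pi>" "t \<le> horizon M"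
  shows "traj M \<pi> t \<in> space (prob_algebra (traj_space M t))"
  using \<open>t \<le> horizon M\<close>
proof (induction t)
  case 0
  have "(\<lambda>_. undefined) \<in> space (traj_space M 0)"
    by (simp add: traj_space_def space_PiM)
  then show ?case using measurable_space[OF measurable_return_prob_space] by auto
next
  case (Suc t)
  then have t: "t < horizon M" and IH: "traj M \<pi> t \<in> space (prob_algebra (traj_space M t))" by auto
  note step = measurable_trajectory_step(1)[OF assms(1,2) t]
  show ?case
    using prob_space_bind'[OF IH step] sets_bind'[OF IH step] by (simp add: space_prob_algebra)
qed

text \<open>Pushforward commutes with \<open>bind\<close>. For an old coordinate the inner map is
  constant in the new state, and since the kernel has mass 1 its image is a Dirac measure, so the
  old marginal survives.\<close>

lemma distr_traj_Suc:
  fixes M :: "('s::second_countable_topology, 'a::second_countable_topology) mdp"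
  assumes "is_mdp M" "admissible M \<pi>" "t < horizon M" "i \<in> {1..Suc t}"
  shows "distr (traj M \<pi> (Suc t)) (state_space M i) (\<lambda>\<xi>. \<xi> i) =
    (if i = Suc t
     then traj M \<pi> t \<bind> (\<lambda>\<xi>. if t = 0 then init M else kernel M t (\<xi> t) (\<pi> t (\<xi> t)))
     else distr (traj M \<pi> t) (state_space M i) (\<lambda>\<xi>. \<xi> i))"
proof -
  let ?K = "\<lambda>\<xi>. if t = 0 then init M else kernel M t (\<xi> t) (\<pi> t (\<xi> t))"
  let ?S = "state_space M i"
  note step = measurable_trajectory_step[OF assms(1-3)]
  have traj: "sets (traj M \<pi> t) = sets (traj_space M t)" "prob_space (traj M \<pi> t)"
    using traj_in_prob_algebra[of M \<pi> t] assms by (auto simp: space_prob_algebra)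
  have space: "space (traj M \<pi> t) = space (traj_space M t)" by (rule sets_eq_imp_space_eq[OF traj(1)])
  have ne: "space (traj M \<pi> t) \<noteq> {}" using prob_space.not_empty[OF traj(2)] .
  have component: "(\<lambda>\<xi>. \<xi> i) \<in> traj_space M (Suc t) \<rightarrow>\<^sub>M ?S"
    unfolding traj_space_def using assms by (intro measurable_component_singleton) auto
  have K: "sets (?K \<xi>) = sets (state_space M (Suc t))" "prob_space (?K \<xi>)"
    if "\<xi> \<in> space (traj_space M t)" for \<xi>
    using measurable_space[OF step(2) that] by (auto simp: space_prob_algebra)
  have "distr (traj M \<pi> (Suc t)) ?S (\<lambda>\<xi>. \<xi> i) =
      traj M \<pi> t \<bind> (\<lambda>\<xi>. distr (distr (?K \<xi>) (traj_space M (Suc t)) (\<lambda>s. \<xi>(Suc t := s))) ?S (\<lambda>\<xi>. \<xi> i))"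
    unfolding traj.simps
    by (rule distr_bind[OF _ ne component])
      (simp add: measurable_cong_sets[OF traj(1) refl] measurable_prob_algebraD[OF step(1)])
  also have "\<dots> = traj M \<pi> t \<bind> (\<lambda>\<xi>. distr (?K \<xi>) ?S (\<lambda>s. (\<xi>(Suc t := s)) i))"
  proof (rule bind_cong[OF refl])
    fix \<xi> assume "\<xi> \<in> space (traj M \<pi> t)"
    then have \<xi>: "\<xi> \<in> space (traj_space M t)" by (simp add: space)
    have "(\<lambda>s. \<xi>(Suc t := s)) \<in> ?K \<xi> \<rightarrow>\<^sub>M traj_space M (Suc t)"
      using step(3)[OF \<xi>] unfolding measurable_cong_sets[OF K(1)[OF \<xi>] refl] .
    from distr_distr[OF component this]
    show "distr (distr (?K \<xi>) (traj_space M (Suc t)) (\<lambda>s. \<xi>(Suc t := s))) ?S (\<lambda>\<xi>. \<xi> i) =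
      distr (?K \<xi>) ?S (\<lambda>s. (\<xi>(Suc t := s)) i)" by (simp add: comp_def)
  qed
  also have "\<dots> = (if i = Suc t then traj M \<pi> t \<bind> ?K
      else distr (traj M \<pi> t) (state_space M i) (\<lambda>\<xi>. \<xi> i))"
  proof (cases "i = Suc t")
    case True
    then show ?thesis
      using K by (auto intro!: bind_cong[OF refl] distr_id2 simp: space)
  next
    case False
    then have i: "i \<in> {1..t}" using assms by auto
    have comp: "(\<lambda>\<xi>. \<xi> i) \<in> traj M \<pi> t \<rightarrow>\<^sub>M ?S"
      unfolding measurable_cong_sets[OF traj(1) refl] traj_space_def
      using i by (intro measurable_component_singleton) auto
    have "traj M \<pi> t \<bind> (\<lambda>\<xi>. distr (?K \<xi>) ?S (\<lambda>s. (\<xi>(Suc t := s)) i)) = traj M \<pi> t \<bind> (\<lambda>\<xi>. return ?S (\<xi> i))"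
    proof (rule bind_cong[OF refl])
      fix \<xi> assume \<xi>: "\<xi> \<in> space (traj M \<pi> t)"
      then show "distr (?K \<xi>) ?S (\<lambda>s. (\<xi>(Suc t := s)) i) = return ?S (\<xi> i)"
        using prob_space.distr_const[OF K(2), of \<xi> "\<xi> i" ?S] measurable_space[OF comp \<xi>] False space by simp
    qed
    also have "\<dots> = distr (traj M \<pi> t) ?S (\<lambda>\<xi>. \<xi> i)"
      by (rule bind_return_distr'[OF ne comp])
    finally show ?thesis using False by simp
  qed
  finally show ?thesis .
qed

text \<open>\<open>state_dist\<close> is defined through the full horizon; transitions after period
  \<open>i\<close> leave its marginal alone, so the trajectory may be cut at any later
  period.\<close>

lemma state_dist_eq_distr_traj:
  fixes M :: "('s::second_countable_topology, 'a::second_countable_topology) mdp"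
  assumes "is_mdp M" "admissible M \<pi>" "i \<in> {1..t}" "t \<le> horizon M"
  shows "state_dist M \<pi> i = distr (traj M \<pi> t) (state_space M i) (\<lambda>\<xi>. \<xi> i)"
  using \<open>t \<le> horizon M\<close> \<open>i \<in> {1..t}\<close>
proof (induction t rule: inc_induct)
  case base
  then show ?case by (simp add: state_dist_def)
next
  case (step t)
  then show ?case using distr_traj_Suc[OF assms(1,2), of t i] by auto
qed

lemma state_dist_1:
  fixes M :: "('s::second_countable_topology, 'a::second_countable_topology) mdp"
  assumes "is_mdp M" "admissible M \<pi>"
  shows "state_dist M \<pi> 1 = init M"
proof -
  have h: "1 \<le> horizon M" using assms by (simp add: is_mdp_def)
  have i: "prob_space (init M)" using assms by (simp add: is_mdp_def space_prob_algebra)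
  have "state_dist M \<pi> 1 = traj M \<pi> 0 \<bind> (\<lambda>\<xi>. init M)"
    using state_dist_eq_distr_traj[OF assms, of 1 1] distr_traj_Suc[OF assms, of 0 1] h by simp
  also have "\<dots> = init M"
    using traj_in_prob_algebra[OF assms, of 0] i
    by (intro bind_const') (auto simp: space_prob_algebra prob_space_imp_subprob_space)
  finally show ?thesis .
qed

lemma sets_state_dist [simp]: "sets (state_dist M \<pi> t) = sets (state_space M t)"
  by (simp add: state_dist_def)

lemma space_state_dist [simp]: "space (state_dist M \<pi> t) = states M t"
  by (simp add: state_dist_def)

text \<open>The Markov property for marginals: the transition sees the trajectory only through its
  current coordinate.\<close>

lemma state_dist_Suc:
  fixes M :: "('s::second_countable_topology, 'a::second_countable_topology) mdp"
  assumes "is_mdp M" "admissible M \<pi>" "1 \<le> t" "t < horizon M"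
  shows "state_dist M \<pi> (Suc t) = state_dist M \<pi> t \<bind> (\<lambda>s. kernel M t s (\<pi> t s))"
proof -
  have traj: "sets (traj M \<pi> t) = sets (traj_space M t)" "prob_space (traj M \<pi> t)"
    using traj_in_prob_algebra[of M \<pi> t] assms by (auto simp: space_prob_algebra)
  have comp: "(\<lambda>\<xi>. \<xi> t) \<in> traj M \<pi> t \<rightarrow>\<^sub>M state_space M t"
    unfolding measurable_cong_sets[OF traj(1) refl] traj_space_def
    using assms by (intro measurable_component_singleton) auto
  have "state_dist M \<pi> (Suc t) = traj M \<pi> t \<bind> (\<lambda>\<xi>. kernel M t (\<xi> t) (\<pi> t (\<xi> t)))"
    using state_dist_eq_distr_traj[OF assms(1,2), of "Suc t" "Suc t"] distr_traj_Suc[OF assms(1,2), of t "Suc t"] assms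
    by simp
  also have "\<dots> = distr (traj M \<pi> t) (state_space M t) (\<lambda>\<xi>. \<xi> t) \<bind> (\<lambda>s. kernel M t s (\<pi> t s))"
    using measurable_prob_algebraD[OF measurable_kernel_policy[OF assms]] prob_space.not_empty[OF traj(2)]
    by (intro bind_distr[OF comp, symmetric]) auto
  also have "\<dots> = state_dist M \<pi> t \<bind> (\<lambda>s. kernel M t s (\<pi> t s))"
    using state_dist_eq_distr_traj[OF assms(1,2), of t t] assms by simp
  finally show ?thesis .
qed

lemma state_dist_cong:
  fixes M :: "('s::second_countable_topology, 'a::second_countable_topology) mdp"
  assumes "is_mdp M" "admissible M \<pi>" "admissible M \<pi>'" "1 \<le> t" "t \<le> horizon M"
    and "\<And>i. 1 \<le> i \<Longrightarrow> i < t \<Longrightarrow> \<pi> i = \<pi>' i"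
  shows "state_dist M \<pi> t = state_dist M \<pi>' t"
  using assms(4-6)
proof (induction t rule: dec_induct)
  case base
  then show ?case using assms(1-3) state_dist_1[of M] by auto
next
  case (step t)
  then show ?case using state_dist_Suc[OF assms(1,2), of t] state_dist_Suc[OF assms(1,3), of t] by auto
qed

text \<open>\<open>admissible\<close> does not contain integrability of \<open>V\<close> under the
  state law. The form \<open>has_bochner_integral\<close> carries it backwards in time along with
  the value, as the tower property requires.\<close>

lemma expectation_V:
  fixes M :: "('s::second_countable_topology, 'a::second_countable_topology) mdp"
  assumes mdp: "is_mdp M" and adm: "admissible M \<pi>" and "1 \<le> t" "t \<le> horizon M"
  shows "has_bochner_integral (state_dist M \<pi> t) (V M \<pi> t)
    (\<Sum>i=t..horizon M. \<integral>s. cost M i s (\<pi> i s) \<partial>state_dist M \<pi> i)"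
  using \<open>t \<le> horizon M\<close> \<open>1 \<le> t\<close>
proof (induction t rule: inc_induct)
  case base
  have "V M \<pi> (horizon M) = (\<lambda>s. cost M (horizon M) s (\<pi> (horizon M) s))"
    by (rule ext, subst V.simps) (simp add: V_beyond fun_eq_iff V.simps[of M \<pi> "Suc (horizon M)"])
  then show ?case
    using adm base by (auto simp: admissible_def intro!: has_bochner_integral_integrable)
next
  case (step t)
  let ?\<rho> = "state_dist M \<pi> t" and ?K = "\<lambda>s. kernel M t s (\<pi> t s)"
  have IH: "has_bochner_integral (state_dist M \<pi> (Suc t)) (V M \<pi> (Suc t))
      (\<Sum>i=Suc t..horizon M. \<integral>s. cost M i s (\<pi> i s) \<partial>state_dist M \<pi> i)"
    using step by auto
  have t: "1 \<le> t" "t < horizon M" using step by auto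
  have \<rho>: "state_dist M \<pi> (Suc t) = ?\<rho> \<bind> ?K" by (rule state_dist_Suc[OF mdp adm t])
  have "has_bochner_integral ?\<rho> (\<lambda>s. \<integral>s'. V M \<pi> (Suc t) s' \<partial>?K s)
      (\<integral>s'. V M \<pi> (Suc t) s' \<partial>(?\<rho> \<bind> ?K))"
  proof (rule has_bochner_integral_bind)
    show "?K \<in> ?\<rho> \<rightarrow>\<^sub>M subprob_algebra (state_space M (Suc t))"
      using measurable_prob_algebraD[OF measurable_kernel_policy[OF mdp adm t]]
      by (simp add: measurable_cong_sets[OF sets_state_dist refl])
    show "V M \<pi> (Suc t) \<in> borel_measurable (state_space M (Suc t))"
      by (rule measurable_V[OF mdp adm]) simp
    show "integrable (?\<rho> \<bind> ?K) (V M \<pi> (Suc t))"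
      using IH by (simp add: \<rho> has_bochner_integral_iff)
    show "integrable (?K s) (V M \<pi> (Suc t))" if "s \<in> space ?\<rho>" for s
      using adm t that by (auto simp: admissible_def)
  qed
  moreover have "(\<integral>s'. V M \<pi> (Suc t) s' \<partial>(?\<rho> \<bind> ?K)) =
      (\<Sum>i=Suc t..horizon M. \<integral>s. cost M i s (\<pi> i s) \<partial>state_dist M \<pi> i)"
    using IH by (simp add: \<rho> has_bochner_integral_iff)
  moreover have "has_bochner_integral ?\<rho> (\<lambda>s. cost M t s (\<pi> t s)) (\<integral>s. cost M t s (\<pi> t s) \<partial>?\<rho>)"
    using adm t by (auto simp: admissible_def intro!: has_bochner_integral_integrable)
  ultimately have "has_bochner_integral ?\<rho> (\<lambda>s. cost M t s (\<pi> t s) + (\<integral>s'. V M \<pi> (Suc t) s' \<partial>?K s))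
      ((\<integral>s. cost M t s (\<pi> t s) \<partial>?\<rho>) +
        (\<Sum>i=Suc t..horizon M. \<integral>s. cost M i s (\<pi> i s) \<partial>state_dist M \<pi> i))"
    by (intro has_bochner_integral_add) simp_all
  moreover have "V M \<pi> t = (\<lambda>s. cost M t s (\<pi> t s) + (\<integral>s'. V M \<pi> (Suc t) s' \<partial>?K s))"
    using t by (subst V.simps) auto
  ultimately show ?case using t by (simp add: sum.atLeast_Suc_atMost)
qed

lemma J_eq_sum_expected_cost:
  fixes M :: "('s::second_countable_topology, 'a::second_countable_topology) mdp"
  assumes mdp: "is_mdp M" and adm: "admissible M \<pi>"
  shows "J M \<pi> = (\<Sum>i=1..horizon M. \<integral>s. cost M i s (\<pi> i s) \<partial>state_dist M \<pi> i)"
proof -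
  let ?\<mu> = "traj M \<pi> (horizon M)"
  have sets: "sets ?\<mu> = sets (traj_space M (horizon M))"
    using traj_in_prob_algebra[OF assms, of "horizon M"] by (simp add: space_prob_algebra)
  have comp: "(\<lambda>\<xi>. \<xi> i) \<in> ?\<mu> \<rightarrow>\<^sub>M state_space M i" if "i \<in> {1..horizon M}" for i
    unfolding measurable_cong_sets[OF sets refl] traj_space_def
    using that by (intro measurable_component_singleton) auto
  have "integrable ?\<mu> (\<lambda>\<xi>. cost M i (\<xi> i) (\<pi> i (\<xi> i)))"
    and "(\<integral>\<xi>. cost M i (\<xi> i) (\<pi> i (\<xi> i)) \<partial>?\<mu>) = (\<integral>s. cost M i s (\<pi> i s) \<partial>state_dist M \<pi> i)"
    if i: "i \<in> {1..horizon M}" for i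
    using integrable_distr_eq[OF comp[OF i] measurable_cost_policy[OF assms i]]
      integral_distr[OF comp[OF i] measurable_cost_policy[OF assms i]] adm i
    by (auto simp: admissible_def state_dist_def)
  then show ?thesis unfolding J_def by (subst Bochner_Integration.integral_sum) auto
qed

subsection \<open>Gradients and normal cones\<close>

lemma has_derivative_within_cong:
  assumes "x \<in> X" "\<And>y. y \<in> X \<Longrightarrow> f y = g y"
  shows "(f has_derivative f') (at x within X) \<longleftrightarrow> (g has_derivative f') (at x within X)"
  using assms by (auto intro: has_derivative_transform[rotated 2])

lemma has_derivative_add_const_iff:
  "((\<lambda>y. c + f y) has_derivative f') F \<longleftrightarrow> (f has_derivative f') F"
  for f :: "'a::real_normed_vector \<Rightarrow> real"
proof
  assume "((\<lambda>y. c + f y) has_derivative f') F"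
  from has_derivative_diff[OF this has_derivative_const[of c]] show "(f has_derivative f') F" by simp
next
  assume "(f has_derivative f') F"
  from has_derivative_add[OF has_derivative_const[of c] this] show "((\<lambda>y. c + f y) has_derivative f') F" by simp
qed

lemma has_derivative_within_shift:
  fixes f g :: "'a::real_normed_vector \<Rightarrow> real"
  assumes "x \<in> X" "\<And>y. y \<in> X \<Longrightarrow> f y = c + g y"
  shows "(f has_derivative f') (at x within X) \<longleftrightarrow> (g has_derivative f') (at x within X)"
  using has_derivative_within_cong[OF assms(1), of f "\<lambda>y. c + g y"] assms(2)
  by (simp add: has_derivative_add_const_iff)

text \<open>Both sides have the same candidates, so \<open>THE\<close> returns the same vector
  whether or not a derivative exists. Equality is asked on \<open>X\<close> only, since nothing is
  known about policies with parameters outside it.\<close>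

lemma gradient_on_shift:
  assumes "x \<in> X" "\<And>y. y \<in> X \<Longrightarrow> f y = c + g y"
  shows "gradient_on X f x = gradient_on X g x"
  by (simp add: gradient_on_def has_derivative_within_shift[OF assms])

lemma differentiable_on_shift:
  fixes f g :: "'a::real_normed_vector \<Rightarrow> real"
  assumes "\<And>y. y \<in> X \<Longrightarrow> f y = c + g y" "g differentiable_on X"
  shows "f differentiable_on X"
  using assms has_derivative_within_shift[of _ X f c g] unfolding differentiable_on_def differentiable_def by blast

lemma normal_cone_0 [simp]: "0 \<in> normal_cone X x"
  by (simp add: normal_cone_def)

lemma normal_cone_prod_0: "(\<lambda>_. 0) \<in> normal_cone_prod T X x"
  by (simp add: normal_cone_prod_def)

text \<open>Testing against points that differ from \<open>x\<close> in coordinate \<open>t\<close>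
  alone kills all other summands.\<close>

lemma normal_cone_prod_component:
  assumes "g \<in> normal_cone_prod T X x" "x \<in> PiE {1..T} X" "t \<in> {1..T}"
  shows "g t \<in> normal_cone (X t) (x t)"
  unfolding normal_cone_def
proof safe
  fix y assume "y \<in> X t"
  then have "x(t := y) \<in> PiE {1..T} X"
    using assms by (auto simp: PiE_iff extensional_def)
  then have "(\<Sum>i=1..T. g i \<bullet> ((x(t := y)) i - x i)) \<le> 0"
    using assms(1) unfolding normal_cone_prod_def by blast
  also have "(\<Sum>i=1..T. g i \<bullet> ((x(t := y)) i - x i)) = (\<Sum>i\<in>{1..T}. if i = t then g t \<bullet> (y - x t) else 0)"
    by (intro sum.cong) auto
  also have "\<dots> = g t \<bullet> (y - x t)" using assms(3) by simp
  finally show "g t \<bullet> (y - x t) \<le> 0" .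
qed

text \<open>Replaces both infima by concrete points. This needs lower bounds: continuity on a
  compact set for \<open>f\<close>, and 0 for the squared norms.\<close>

lemma PLK_normal_vector:
  assumes PLK: "PLK X f \<mu>" and "compact X" and x: "x \<in> X" "z \<in> X" and g: "g \<in> normal_cone X x"
  shows "2 * \<mu> * (f x - f z) \<le> (norm (gradient_on X f x + g))\<^sup>2"
proof -
  have \<mu>: "0 < \<mu>" and diff: "f differentiable_on X" using PLK by (auto simp: PLK_def)
  have "compact (f ` X)"
    using \<open>compact X\<close> differentiable_imp_continuous_on[OF diff] by (rule compact_continuous_image[rotated])
  then have bdd: "bdd_below (f ` X)" by (intro bounded_imp_bdd_below compact_imp_bounded)
  have "f x - f z \<le> f x - (INF y\<in>X. f y)"
    using cINF_lower[OF bdd x(2)] by simp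
  also have "\<dots> \<le> 1 / (2 * \<mu>) * (INF g\<in>normal_cone X x. (norm (gradient_on X f x + g))\<^sup>2)"
    using PLK x by (auto simp: PLK_def)
  also have "\<dots> \<le> 1 / (2 * \<mu>) * (norm (gradient_on X f x + g))\<^sup>2"
    using \<mu> g by (intro mult_left_mono cINF_lower bdd_belowI2[where m = 0]) auto
  finally show ?thesis using \<mu> by (simp add: field_simps)
qed

subsection \<open>Decomposition of the objective\<close>

lemma join_params_PiE:
  assumes "\<theta> \<in> PiE {1..T} \<Theta>" "\<theta>' \<in> PiE {1..T} \<Theta>"
  shows "join_params k \<theta> \<theta>' \<in> PiE {1..T} \<Theta>"
  using assms by (auto simp: PiE_iff join_params_def extensional_def)

lemma join_params_upd:
  assumes "1 \<le> t"
  shows "(join_params (t - 1) \<theta> \<theta>')(t := \<theta> t) = join_params t \<theta> \<theta>'"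
    and "(join_params (t - 1) \<theta> \<theta>')(t := \<theta>' t) = join_params (t - 1) \<theta> \<theta>'"
  using assms by (auto simp: join_params_def fun_eq_iff)

lemma join_params_self [simp]: "join_params k \<theta> \<theta> = \<theta>"
  by (auto simp: join_params_def)

text \<open>Serves to identify the expected Q-value of a joined parameter under its own policy with
  the expected optimal Q-value in the state law of \<theta>.\<close>

lemma expected_Q_cong:
  fixes M :: "('s::second_countable_topology, 'a::second_countable_topology) mdp"
  assumes mdp: "is_mdp M"
    and adm: "\<And>\<theta>. \<theta> \<in> PiE {1..horizon M} \<Theta> \<Longrightarrow> admissible M (policy_of pol \<theta>)"
    and t: "t \<in> {1..horizon M}"
    and "\<theta> \<in> PiE {1..horizon M} \<Theta>" "\<eta> \<in> PiE {1..horizon M} \<Theta>"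
    and "\<And>i. 1 \<le> i \<Longrightarrow> i < t \<Longrightarrow> \<theta> i = \<eta> i"
    and "\<And>i. t < i \<Longrightarrow> i \<le> horizon M \<Longrightarrow> \<theta>' i = \<eta>' i"
  shows "expected_Q M pol \<theta> \<theta>' t = expected_Q M pol \<eta> \<eta>' t"
proof -
  have "state_dist M (policy_of pol \<theta>) t = state_dist M (policy_of pol \<eta>) t"
    using assms by (intro state_dist_cong) (auto simp: policy_of_def[abs_def])
  moreover have "Q M (policy_of pol \<theta>') t = Q M (policy_of pol \<eta>') t"
    using assms by (intro Q_cong) (auto simp: policy_of_def[abs_def])
  ultimately show ?thesis by (simp add: expected_Q_def fun_eq_iff)
qed

text \<open>Costs before period \<open>t\<close> do not see \<open>x\<close>, and the remaining cost
  is the expectation of \<open>V\<close> at period \<open>t\<close>, that is of \<open>Q\<close> at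
  the action chosen by \<open>x\<close>. As functions of \<open>x\<close>, objective and expected
  Q-value thus differ by a constant.\<close>

lemma objective_decomposition:
  fixes M :: "('s::second_countable_topology, 'a::second_countable_topology) mdp"
  assumes mdp: "is_mdp M"
    and adm: "\<And>\<theta>. \<theta> \<in> PiE {1..horizon M} \<Theta> \<Longrightarrow> admissible M (policy_of pol \<theta>)"
    and t: "t \<in> {1..horizon M}" and x: "x \<in> \<Theta> t"
    and \<theta>: "\<theta> \<in> PiE {1..horizon M} \<Theta>" "\<theta>' \<in> PiE {1..horizon M} \<Theta>"
  shows "objective M pol ((join_params (t - 1) \<theta> \<theta>')(t := x)) =
      (\<Sum>i=1..<t. \<integral>s. cost M i s (pol i (\<theta> i) s) \<partial>state_dist M (policy_of pol \<theta>) i)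
        + expected_Q M pol \<theta> \<theta>' t x"
    and "integrable (state_dist M (policy_of pol \<theta>) t) (\<lambda>s. Q M (policy_of pol \<theta>') t s (pol t x s))"
proof -
  define \<eta> where "\<eta> = (join_params (t - 1) \<theta> \<theta>')(t := x)"
  let ?\<pi> = "policy_of pol \<eta>" and ?\<rho> = "state_dist M (policy_of pol \<theta>)"
  have \<eta>: "\<eta> \<in> PiE {1..horizon M} \<Theta>"
    using join_params_PiE[OF \<theta>, of "t - 1"] t x by (auto simp: \<eta>_def PiE_iff extensional_def)
  have before: "\<eta> i = \<theta> i" if "i < t" for i using that by (auto simp: \<eta>_def join_params_def)
  have at: "\<eta> t = x" by (simp add: \<eta>_def)
  have after: "\<eta> i = \<theta>' i" if "t < i" for i using that by (auto simp: \<eta>_def join_params_def)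
  have \<rho>: "state_dist M ?\<pi> i = ?\<rho> i" if "1 \<le> i" "i \<le> t" for i
    using that t before adm[OF \<eta>] adm[OF \<theta>(1)] by (intro state_dist_cong[OF mdp]) (auto simp: policy_of_def[abs_def])
  have Q: "Q M ?\<pi> t = Q M (policy_of pol \<theta>') t"
    using after by (intro Q_cong) (auto simp: policy_of_def[abs_def])
  have V: "V M ?\<pi> t = (\<lambda>s. Q M (policy_of pol \<theta>') t s (pol t x s))"
    using t by (auto simp: V_eq_Q Q fun_eq_iff policy_of_def at)
  have EV: "has_bochner_integral (?\<rho> t) (\<lambda>s. Q M (policy_of pol \<theta>') t s (pol t x s))
      (\<Sum>i=t..horizon M. \<integral>s. cost M i s (?\<pi> i s) \<partial>state_dist M ?\<pi> i)"
    using expectation_V[OF mdp adm[OF \<eta>], of t] t by (simp add: V \<rho>)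
  then show "integrable (?\<rho> t) (\<lambda>s. Q M (policy_of pol \<theta>') t s (pol t x s))"
    by (simp add: has_bochner_integral_iff)
  have "objective M pol \<eta> = (\<Sum>i=1..horizon M. \<integral>s. cost M i s (?\<pi> i s) \<partial>state_dist M ?\<pi> i)"
    unfolding objective_def by (rule J_eq_sum_expected_cost[OF mdp adm[OF \<eta>]])
  also have "\<dots> = (\<Sum>i=1..<t. \<integral>s. cost M i s (?\<pi> i s) \<partial>state_dist M ?\<pi> i)
      + (\<Sum>i=t..horizon M. \<integral>s. cost M i s (?\<pi> i s) \<partial>state_dist M ?\<pi> i)"
    using t by (subst sum.union_disjoint[symmetric]) (auto intro!: sum.cong)
  also have "(\<Sum>i=1..<t. \<integral>s. cost M i s (?\<pi> i s) \<partial>state_dist M ?\<pi> i) =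
      (\<Sum>i=1..<t. \<integral>s. cost M i s (pol i (\<theta> i) s) \<partial>?\<rho> i)"
    by (intro sum.cong) (auto simp: \<rho> before policy_of_def)
  also have "(\<Sum>i=t..horizon M. \<integral>s. cost M i s (?\<pi> i s) \<partial>state_dist M ?\<pi> i) = expected_Q M pol \<theta> \<theta>' t x"
    using EV by (simp add: has_bochner_integral_iff expected_Q_def)
  finally show "objective M pol ((join_params (t - 1) \<theta> \<theta>')(t := x)) =
      (\<Sum>i=1..<t. \<integral>s. cost M i s (pol i (\<theta> i) s) \<partial>?\<rho> i) + expected_Q M pol \<theta> \<theta>' t x"
    by (simp only: \<eta>_def)
qed

text \<open>The decomposition with both parameters equal to \<theta>, where the joined parameter is
  \<theta> itself and the additive constant drops out of derivatives.\<close>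

lemma objective_partial:
  fixes M :: "('s::second_countable_topology, 'a::second_countable_topology) mdp"
    and \<Theta> :: "nat \<Rightarrow> 'p::euclidean_space set"
  assumes mdp: "is_mdp M"
    and adm: "\<And>\<theta>. \<theta> \<in> PiE {1..horizon M} \<Theta> \<Longrightarrow> admissible M (policy_of pol \<theta>)"
    and t: "t \<in> {1..horizon M}" and \<theta>: "\<theta> \<in> PiE {1..horizon M} \<Theta>"
  shows "partial_gradient \<Theta> (objective M pol) t \<theta> = gradient_on (\<Theta> t) (expected_Q M pol \<theta> \<theta> t) (\<theta> t)"
    and "expected_Q M pol \<theta> \<theta> t differentiable_on \<Theta> t \<Longrightarrow>
      (\<lambda>y. objective M pol (\<theta>(t := y))) differentiable_on \<Theta> t"
proof -
  have \<theta>t: "\<theta> t \<in> \<Theta> t" using \<theta> t by auto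
  have shift: "objective M pol (\<theta>(t := y)) =
      (\<Sum>i=1..<t. \<integral>s. cost M i s (pol i (\<theta> i) s) \<partial>state_dist M (policy_of pol \<theta>) i)
        + expected_Q M pol \<theta> \<theta> t y" if "y \<in> \<Theta> t" for y
    using objective_decomposition(1)[where \<Theta> = \<Theta>, OF mdp adm t that \<theta> \<theta>] by simp
  show "partial_gradient \<Theta> (objective M pol) t \<theta> = gradient_on (\<Theta> t) (expected_Q M pol \<theta> \<theta> t) (\<theta> t)"
    unfolding partial_gradient_def by (rule gradient_on_shift[OF \<theta>t shift])
  show "expected_Q M pol \<theta> \<theta> t differentiable_on \<Theta> t \<Longrightarrow>
      (\<lambda>y. objective M pol (\<theta>(t := y))) differentiable_on \<Theta> t"
    by (rule differentiable_on_shift[OF shift])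
qed

section \<open>From gradient comparison to the PLK inequality of the objective\<close>

lemma norm_telescope_le:
  fixes p :: "nat \<Rightarrow> 'v::real_normed_vector"
  assumes "t \<le> T" "\<And>k. t < k \<Longrightarrow> k \<le> T \<Longrightarrow> norm (p k - p (k - 1)) \<le> b k"
  shows "norm (p T - p t) \<le> (\<Sum>k=Suc t..T. b k)"
  using assms
proof (induction T rule: dec_induct)
  case (step n)
  have "norm (p (Suc n) - p t) \<le> norm (p (Suc n) - p n) + norm (p n - p t)"
    using norm_triangle_ineq[of "p (Suc n) - p n" "p n - p t"] by simp
  also have "\<dots> \<le> b (Suc n) + (\<Sum>k=Suc t..n. b k)"
    using step.IH step.prems(1)[of "Suc n"] step by (intro add_mono) auto
  finally show ?case using step by simp
qed simp

theorem theorem1: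
  fixes M :: "(real ^ 'm, real ^ 'n) mdp"
    and T :: nat
    and \<Theta> :: "nat \<Rightarrow> (real ^ 'd) set"
    and pol :: "nat \<Rightarrow> real ^ 'd \<Rightarrow> real ^ 'm \<Rightarrow> real ^ 'n"
    and \<theta>s :: "nat \<Rightarrow> real ^ 'd"
    and Vopt :: "nat \<Rightarrow> real ^ 'm \<Rightarrow> real"
    and Qopt :: "nat \<Rightarrow> real ^ 'm \<Rightarrow> real ^ 'n \<Rightarrow> real"
    and G \<mu>\<^sub>Q M\<^sub>g :: real
  assumes mdp: "is_mdp M" and T: "T = horizon M"
    and params: "\<And>t. t \<in> {1..T} \<Longrightarrow> convex (\<Theta> t) \<and> compact (\<Theta> t)"
    and admissible: "\<And>\<theta>. \<theta> \<in> PiE {1..T} \<Theta> \<Longrightarrow> admissible M (policy_of pol \<theta>)"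
    and minimizer: "\<theta>s \<in> PiE {1..T} \<Theta>"
      "\<And>\<theta>. \<theta> \<in> PiE {1..T} \<Theta> \<Longrightarrow> objective M pol \<theta>s \<le> objective M pol \<theta>"
    and contains_optimal: "\<exists>\<theta>\<in>PiE {1..T} \<Theta>. \<forall>\<pi>. admissible M \<pi> \<longrightarrow> J M (policy_of pol \<theta>) \<le> J M \<pi>"
    and optimal: "optimal_value_functions M Vopt Qopt"
      "\<And>t s. t \<in> {1..T} \<Longrightarrow> s \<in> states M t \<Longrightarrow> V M (policy_of pol \<theta>s) t s = Vopt t s"
      "\<And>t s a. t \<in> {1..T} \<Longrightarrow> s \<in> states M t \<Longrightarrow> a \<in> actions M s \<Longrightarrow>
         Q M (policy_of pol \<theta>s) t s a = Qopt t s a"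
    and bounded_gradients: "\<And>\<theta> t. \<theta> \<in> PiE {1..T} \<Theta> \<Longrightarrow> t \<in> {1..T} \<Longrightarrow>
      expected_Q M pol \<theta> \<theta> t differentiable_on \<Theta> t \<and>
      continuous_on (\<Theta> t) (gradient_on (\<Theta> t) (expected_Q M pol \<theta> \<theta> t)) \<and>
      (\<forall>x\<in>\<Theta> t. norm (gradient_on (\<Theta> t) (expected_Q M pol \<theta> \<theta> t) x) \<le> G)"
    and PLK_Q: "\<And>\<theta> t. \<theta> \<in> PiE {1..T} \<Theta> \<Longrightarrow> t \<in> {1..T} \<Longrightarrow>
      PLK (\<Theta> t) (expected_Q M pol \<theta> \<theta>s t) \<mu>\<^sub>Q"
    and M\<^sub>g_pos: "0 < M\<^sub>g"
    and decomposition: "\<And>\<theta> t k. \<theta> \<in> PiE {1..T} \<Theta> \<Longrightarrow> 1 \<le> t \<Longrightarrow> t < k \<Longrightarrow> k \<le> T \<Longrightarrow>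
      norm (partial_gradient \<Theta> (objective M pol) t (join_params k \<theta> \<theta>s)
          - partial_gradient \<Theta> (objective M pol) t (join_params (k - 1) \<theta> \<theta>s))
        \<le> M\<^sub>g * (expected_Q M pol \<theta> \<theta>s k (\<theta> k) - expected_Q M pol \<theta> \<theta>s k (\<theta>s k))"
    (* Every larger constant also satisfies the decomposition inequality. If M_g is too small
       (e.g. T = 1, where that inequality is void), the conclusion fails. *)
    and normalization: "\<mu>\<^sub>Q \<le> M\<^sub>g * G * real T"
  shows "PLK_prod T \<Theta> (objective M pol) (\<mu>\<^sub>Q ^ 3 / (exp 1 * M\<^sub>g\<^sup>2 * G\<^sup>2 * (real T)\<^sup>2)) \<and>
    (\<forall>\<theta>\<in>PiE {1..T} \<Theta>. objective M pol \<theta> - objective M pol \<theta>s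
       \<le> exp 1 * M\<^sub>g\<^sup>2 * G\<^sup>2 * (real T)\<^sup>2 / (2 * \<mu>\<^sub>Q ^ 3) * stationarity_gap T \<Theta> (objective M pol) \<theta>)"
proof -
  let ?l = "objective M pol"
  define c where "c = exp 1 * M\<^sub>g\<^sup>2 * G\<^sup>2 * (real T)\<^sup>2 / (2 * \<mu>\<^sub>Q ^ 3)"
  have T1: "1 \<le> T" using mdp T by (simp add: is_mdp_def)
  have \<mu>0: "0 < \<mu>\<^sub>Q" using PLK_Q[OF minimizer(1), of 1] T1 by (auto simp: PLK_def)
  \<comment> \<open>The gradient bound alone gives \<open>0 \<le> G\<close>; strictness comes from
    \<open>normalization\<close>.\<close>
  have "0 < M\<^sub>g * real T * G" using normalization \<mu>0 by (simp add: ac_simps)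
  then have G0: "0 < G" using M\<^sub>g_pos T1 by (intro zero_less_mult_pos[of "M\<^sub>g * real T" G]) auto
  note admH = admissible[unfolded T]
  have main: "?l \<theta> - ?l \<theta>s \<le> c * stationarity_gap T \<Theta> ?l \<theta>" if \<theta>: "\<theta> \<in> PiE {1..T} \<Theta>" for \<theta>
  proof -
    define \<delta> where "\<delta> k = expected_Q M pol \<theta> \<theta>s k (\<theta> k) - expected_Q M pol \<theta> \<theta>s k (\<theta>s k)" for k
    have join: "join_params k \<theta> \<theta>s \<in> PiE {1..T} \<Theta>" for k
      by (rule join_params_PiE[OF \<theta> minimizer(1)])
    \<comment> \<open>Outside \<open>{1..T}\<close> the two parameters agree because elements of
      \<open>PiE\<close> are \<open>undefined\<close> there.\<close>
    have join_T: "join_params T \<theta> \<theta>s = \<theta>" and join_0: "join_params 0 \<theta> \<theta>s = \<theta>s"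
      using \<theta> minimizer(1) by (auto simp: join_params_def fun_eq_iff PiE_iff extensional_def)
    note split = objective_decomposition[where \<Theta> = \<Theta> and pol = pol, OF mdp admH _ _
        \<theta>[unfolded T] minimizer(1)[unfolded T]]
    \<comment> \<open>The states follow \<theta>, so minimality of \<open>\<theta>s\<close> for the
      objective does not apply; the comparison is pointwise in the state, by the optimality
      equations.\<close>
    have \<delta>_nonneg: "0 \<le> \<delta> k" if k: "k \<in> {1..T}" for k
    proof -
      have mem: "\<theta> k \<in> \<Theta> k" "\<theta>s k \<in> \<Theta> k" using k \<theta> minimizer(1) by auto
      have "expected_Q M pol \<theta> \<theta>s k (\<theta>s k) \<le> expected_Q M pol \<theta> \<theta>s k (\<theta> k)"
        unfolding expected_Q_def
      proof (rule integral_mono)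
        fix s assume "s \<in> space (state_dist M (policy_of pol \<theta>) k)"
        then have s: "s \<in> states M k" by simp
        have a: "pol k (\<theta> k) s \<in> actions M s"
          using admissible[OF \<theta>] k s unfolding admissible_def policy_of_def T by blast
        have "Q M (policy_of pol \<theta>s) k s (pol k (\<theta>s k) s) = Vopt k s"
          using V_eq_Q[of k M "policy_of pol \<theta>s" s] optimal(2)[OF k s] k T by (simp add: policy_of_def)
        also have "\<dots> \<le> Qopt k s (pol k (\<theta> k) s)"
          using optimal(1) k s a unfolding optimal_value_functions_def T by blast
        finally show "Q M (policy_of pol \<theta>s) k s (pol k (\<theta>s k) s) \<le> Q M (policy_of pol \<theta>s) k s (pol k (\<theta> k) s)"
          using optimal(3)[OF k s a] by simp
      qed (use split(2)[of k] k T mem in auto)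
      then show ?thesis by (simp add: \<delta>_def)
    qed
    have "?l (join_params k \<theta> \<theta>s) - ?l (join_params (k - 1) \<theta> \<theta>s) = \<delta> k" if k: "k \<in> {1..T}" for k
    proof -
      have "1 \<le> k" and mem: "\<theta> k \<in> \<Theta> k" "\<theta>s k \<in> \<Theta> k" using k \<theta> minimizer(1) by auto
      note upd = join_params_upd[OF \<open>1 \<le> k\<close>]
      show ?thesis
        using split(1)[of k "\<theta> k", unfolded upd] split(1)[of k "\<theta>s k", unfolded upd] k T mem
        by (simp add: \<delta>_def)
    qed
    then have "(\<Sum>k=1..T. \<delta> k) = (\<Sum>k=Suc 0..T. ?l (join_params k \<theta> \<theta>s) - ?l (join_params (k - 1) \<theta> \<theta>s))"
      by (intro sum.cong) auto
    also have "\<dots> = ?l \<theta> - ?l \<theta>s"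
      using sum_telescope''[of 0 T "\<lambda>k. ?l (join_params k \<theta> \<theta>s)"] join_T join_0 by simp
    finally have sum_\<delta>: "(\<Sum>k=1..T. \<delta> k) = ?l \<theta> - ?l \<theta>s" .

    \<comment> \<open>After period \<open>t\<close> the joined parameter follows
      \<open>\<theta>s\<close>, so its own Q-function at \<open>t\<close> is the optimal one. Thus
      \<open>bounded_gradients\<close>, used at the joined parameter, bounds the gradient in the PLK
      condition.\<close>
    have grad: "partial_gradient \<Theta> ?l t (join_params t \<theta> \<theta>s) =
        gradient_on (\<Theta> t) (expected_Q M pol \<theta> \<theta>s t) (\<theta> t)" (is ?grad)
      and grad_G: "norm (gradient_on (\<Theta> t) (expected_Q M pol \<theta> \<theta>s t) (\<theta> t)) \<le> G" (is ?grad_G)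
      if t: "t \<in> {1..T}" for t
    proof -
      let ?\<eta> = "join_params t \<theta> \<theta>s"
      have Q: "expected_Q M pol ?\<eta> ?\<eta> t = expected_Q M pol \<theta> \<theta>s t"
        by (rule expected_Q_cong[where \<Theta> = \<Theta>, OF mdp admH])
          (use t T join \<theta> in \<open>auto simp: join_params_def\<close>)
      have \<eta>t: "?\<eta> t = \<theta> t" by (simp add: join_params_def)
      show ?grad
        using objective_partial(1)[where \<Theta> = \<Theta> and pol = pol, OF mdp admH _ join[unfolded T], of t t] t T
        by (simp add: Q \<eta>t)
      have "\<theta> t \<in> \<Theta> t" using \<theta> t by auto
      then show ?grad_G using bounded_gradients[OF join t, of t] by (auto simp: Q)
    qed
    have PLK_step: "2 * \<mu>\<^sub>Q * \<delta> t \<le> (norm (gradient_on (\<Theta> t) (expected_Q M pol \<theta> \<theta>s t) (\<theta> t) + h))\<^sup>2"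
      if t: "t \<in> {1..T}" and h: "h \<in> normal_cone (\<Theta> t) (\<theta> t)" for t h
    proof -
      have "\<theta> t \<in> \<Theta> t" "\<theta>s t \<in> \<Theta> t" using t \<theta> minimizer(1) by auto
      then show ?thesis
        unfolding \<delta>_def using PLK_normal_vector[OF PLK_Q[OF \<theta> t] _ _ _ h] params[OF t] by blast
    qed
    have crude: "2 * \<mu>\<^sub>Q * \<delta> t \<le> G\<^sup>2" if t: "t \<in> {1..T}" for t
      using PLK_step[OF t normal_cone_0] power_mono[OF grad_G[OF t], of 2] by simp
    have bound: "?l \<theta> - ?l \<theta>s \<le> c * (\<Sum>t=1..T. (norm (partial_gradient \<Theta> ?l t \<theta> + g t))\<^sup>2)"
      if g: "g \<in> normal_cone_prod T \<Theta> \<theta>" for g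
    proof -
      define a where "a t = norm (partial_gradient \<Theta> ?l t \<theta> + g t)" for t
      have rec: "2 * \<mu>\<^sub>Q * \<delta> t \<le> (a t + M\<^sub>g * (\<Sum>k=Suc t..T. \<delta> k))\<^sup>2" if t: "t \<in> {1..T}" for t
      proof -
        let ?p = "\<lambda>k. partial_gradient \<Theta> ?l t (join_params k \<theta> \<theta>s)"
        \<comment> \<open>Replacing \<open>\<theta>s k\<close> by \<open>\<theta> k\<close> for k =
          t+1, ..., T moves the gradient by at most \<open>M\<^sub>g * \<delta> k\<close> each time.
          Coordinate \<open>t\<close> stays \<open>\<theta> t\<close> throughout, so
          \<open>g t\<close> remains a normal vector.\<close>
        have "norm (?p T - ?p t) \<le> (\<Sum>k=Suc t..T. M\<^sub>g * \<delta> k)"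
          using t decomposition[OF \<theta>, of t] by (intro norm_telescope_le) (auto simp: \<delta>_def)
        then have "norm (?p t - ?p T) \<le> M\<^sub>g * (\<Sum>k=Suc t..T. \<delta> k)"
          by (simp add: norm_minus_commute sum_distrib_left)
        then have "norm (?p t + g t) \<le> a t + M\<^sub>g * (\<Sum>k=Suc t..T. \<delta> k)"
          using norm_triangle_ineq[of "?p T + g t" "?p t - ?p T"] by (simp add: a_def join_T add.commute)
        then have "(norm (?p t + g t))\<^sup>2 \<le> (a t + M\<^sub>g * (\<Sum>k=Suc t..T. \<delta> k))\<^sup>2"
          by (intro power_mono) auto
        then show ?thesis
          using PLK_step[OF t normal_cone_prod_component[OF g \<theta> t]] grad[OF t] by simp
      qed
      \<comment> \<open>Translates the backward count: the first \<open>n\<close> reversed terms are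
        those of the periods after \<open>T - n\<close>.\<close>
      have reverse: "(\<Sum>i<n. f (T - i)) = (\<Sum>k=Suc (T - n)..T. f k)" if "n \<le> T" for n and f :: "nat \<Rightarrow> real"
        using that by (intro sum.reindex_bij_witness[of _ "\<lambda>k. T - k" "\<lambda>i. T - i"]) auto
      have "(\<Sum>i<T. \<delta> (T - i)) \<le> c * (\<Sum>i<T. (a (T - i))\<^sup>2)"
        unfolding c_def
      proof (rule recursive_quadratic_bound[OF \<mu>0 M\<^sub>g_pos G0 normalization])
        fix n assume n: "n < T"
        then have Tn: "T - n \<in> {1..T}" by auto
        show "0 \<le> \<delta> (T - n)" by (rule \<delta>_nonneg[OF Tn])
        show "2 * \<mu>\<^sub>Q * \<delta> (T - n) \<le> G\<^sup>2" by (rule crude[OF Tn])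
        show "2 * \<mu>\<^sub>Q * \<delta> (T - n) \<le> (a (T - n) + M\<^sub>g * (\<Sum>i<n. \<delta> (T - i)))\<^sup>2"
          using rec[OF Tn] reverse[of n \<delta>] n by simp
      qed
      then show ?thesis
        using reverse[of T \<delta>] reverse[of T "\<lambda>t. (a t)\<^sup>2"] sum_\<delta> by (simp add: a_def)
    qed
    have c0: "0 < c" unfolding c_def using \<mu>0 M\<^sub>g_pos G0 T1 by simp
    \<comment> \<open>Division by the positive \<open>c\<close> makes the left side a lower bound
      for every value under the infimum.\<close>
    have "(?l \<theta> - ?l \<theta>s) / c \<le> stationarity_gap T \<Theta> ?l \<theta>"
      unfolding stationarity_gap_def
    proof (rule cINF_greatest)
      show "normal_cone_prod T \<Theta> \<theta> \<noteq> {}" using normal_cone_prod_0 by blast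
    qed (use bound c0 in \<open>simp add: field_simps\<close>)
    then show ?thesis using c0 by (simp add: field_simps)
  qed
  have INF: "(INF y\<in>PiE {1..T} \<Theta>. ?l y) = ?l \<theta>s"
    using minimizer by (intro cInf_eq_minimum) auto
  have const: "1 / (2 * (\<mu>\<^sub>Q ^ 3 / (exp 1 * M\<^sub>g\<^sup>2 * G\<^sup>2 * (real T)\<^sup>2))) = c"
    using \<mu>0 by (simp add: c_def)
  have "(\<lambda>y. ?l (\<theta>(t := y))) differentiable_on \<Theta> t" if "\<theta> \<in> PiE {1..T} \<Theta>" "t \<in> {1..T}" for \<theta> t
    using objective_partial(2)[where \<Theta> = \<Theta> and pol = pol, OF mdp admH, of t \<theta>] bounded_gradients[OF that] that T by auto
  moreover have "0 < \<mu>\<^sub>Q ^ 3 / (exp 1 * M\<^sub>g\<^sup>2 * G\<^sup>2 * (real T)\<^sup>2)"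
    using \<mu>0 M\<^sub>g_pos G0 T1 by simp
  ultimately show ?thesis
    unfolding PLK_prod_def INF const using main unfolding c_def by auto
qed

end
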